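(* Let $\alpha\in[0,1]$, $m\in(0,1]$, and let $f:(0,\infty)\to\mathbb{R}$ be a harmonically $(\alpha,m)$-convex function. If $0<a<b<\infty$ and $f\in L[a,b]$, then $$\frac{ab}{b-a}\int_a^b\frac{f(x)}{x^2}\,dx\le \min\left\{\frac{f(a)+\alpha m f\left(\frac{b}{m}\right)}{\alpha+1},\ \frac{f(b)+\alpha m f\left(\frac{a}{m}\right)}{\alpha+1}\right\}.$$
   Context: For $\alpha\in[0,1]$ and $m\in(0,1]$, a function $f:(0,\infty)\to\mathbb{R}$ is called harmonically $(\alpha,m)$-convex if for all $x,y\in(0,\infty)$ and $t\in[0,1]$, $$f\left(\frac{mxy}{mty+(1-t)x}\right)=f\left(\left(\frac{t}{x}+\frac{1-t}{my}\right)^{-1}\right)\le t^{\alpha}f(x)+m(1-t^{\alpha})f(y).$$ $L[a,b]$ denotes the Lebesgue integrable functions on $[a,b]$. *)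

theory Defs
  imports "HOL-Analysis.Analysis"
begin

text \<open>
  Real powers of a nonnegative base with the convention \<open>0 ^ 0 = 1\<close>;
  HOL's \<^const>\<open>powr\<close> has \<open>0 powr 0 = 0\<close>.
\<close>

definition rpow :: "real \<Rightarrow> real \<Rightarrow> real"
  where "rpow t \<alpha> = (if \<alpha> = 0 then 1 else t powr \<alpha>)"

text \<open>
  A function on the open half-line \<open>(0, \<infinity>)\<close> is represented by a total function on the reals;
  for \<open>m > 0\<close> its values outside the half-line do not matter.
\<close>

definition harmonically_convex :: "real \<Rightarrow> real \<Rightarrow> (real \<Rightarrow> real) \<Rightarrow> bool"
  where "harmonically_convex \<alpha> m f \<longleftrightarrow>
    (\<forall>x\<in>{0<..}. \<forall>y\<in>{0<..}. \<forall>t\<in>{0..1}.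
      f (m * x * y / (m * t * y + (1 - t) * x))
        \<le> rpow t \<alpha> * f x + m * (1 - rpow t \<alpha>) * f y)"

end

theory Submission
  imports Defs
begin

text \<open>
  The reciprocals of the points of \<open>[a, b]\<close> fill the segment between \<open>1 / a\<close> and \<open>1 / b\<close>. Let
  \<open>(p, q)\<close> be one of \<open>(a, b)\<close> and \<open>(b, a)\<close>, and let \<open>T u\<close> be the affine coordinate of \<open>1 / u\<close>
  in that segment, with value \<open>1\<close> at \<open>u = p\<close> and \<open>0\<close> at \<open>u = q\<close>. Harmonic convexity at the pair
  \<open>p\<close>, \<open>q / m\<close> with parameter \<open>T u\<close> is a pointwise upper bound,
  \[ f(u) \le T(u)^\alpha f(p) + m (1 - T(u)^\alpha) f(q / m), \]
  whose factor \<open>m\<close> is absorbed by the division in \<open>q / m\<close>.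
  The weight \<open>1 / u\<^sup>2\<close> is, up to the factor \<open>1 / p - 1 / q\<close>, minus the derivative of \<open>T\<close>. Therefore
  the weighted integral of \<open>T ^ \<alpha>\<close> is \<open>(b - a) / (a b)\<close> times \<open>1 / (\<alpha> + 1)\<close>,
  and integrating the pointwise bound gives one of the two terms of the minimum for each choice of
  \<open>(p, q)\<close>.

  Working with the variable \<open>u\<close> throughout, instead of substituting \<open>u = 1 / (t / p + (1 - t) / q)\<close>,
  means that only the explicit majorant needs an antiderivative, and no change of variables has
  to be justified for the merely integrable function \<open>f\<close>.
\<close>

definition harmonic_coord :: "real \<Rightarrow> real \<Rightarrow> real \<Rightarrow> real"
  where "harmonic_coord p q u = (1 / u - 1 / q) / (1 / p - 1 / q)"

lemma harmonic_coord_ends: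
  assumes "0 < p" "0 < q" "p \<noteq> q"
  shows "harmonic_coord p q p = 1" "harmonic_coord p q q = 0"
  using assms by (auto simp: harmonic_coord_def field_simps)

lemma harmonic_coord_swap:
  assumes "0 < p" "0 < q" "p \<noteq> q" "0 < u"
  shows "harmonic_coord q p u = 1 - harmonic_coord p q u"
proof -
  have "1 / p - 1 / q \<noteq> 0" using assms by (simp add: field_simps)
  moreover have "harmonic_coord q p u = (1 / p - 1 / u) / (1 / p - 1 / q)"
    unfolding harmonic_coord_def by (metis minus_diff_eq minus_divide_divide)
  moreover have "(x - v) / (x - y) = 1 - (v - y) / (x - y)" if "x - y \<noteq> 0" for x y v :: real
    using that by (simp add: divide_simps)
  ultimately show ?thesis
    by (simp only: harmonic_coord_def)
qed

lemma harmonic_coord_mem: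
  assumes "0 < a" "a < b" "(p, q) = (a, b) \<or> (p, q) = (b, a)" "u \<in> {a..b}"
  shows "harmonic_coord p q u \<in> {0..1}"
    and "u \<in> {a<..<b} \<Longrightarrow> 0 < harmonic_coord p q u"
proof -
  have D: "0 < 1 / a - 1 / b" using assms by (simp add: field_simps)
  have "1 / b \<le> 1 / u" "1 / u \<le> 1 / a" using assms by (auto intro: divide_left_mono)
  then have *: "harmonic_coord a b u \<in> {0..1}"
    using D by (simp add: harmonic_coord_def)
  have **: "0 < harmonic_coord a b u \<and> harmonic_coord a b u < 1" if "u \<in> {a<..<b}"
  proof -
    have "1 / b < 1 / u" "1 / u < 1 / a" using assms that by (auto intro!: divide_strict_left_mono)
    then show ?thesis using D by (simp add: harmonic_coord_def)
  qed
  have sw: "harmonic_coord b a u = 1 - harmonic_coord a b u"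
    using assms by (intro harmonic_coord_swap) auto
  show "harmonic_coord p q u \<in> {0..1}" using assms(3) * sw by auto
  show "u \<in> {a<..<b} \<Longrightarrow> 0 < harmonic_coord p q u" using assms(3) ** sw by auto
qed

lemma harmonic_coord_deriv:
  assumes "0 < p" "0 < q" "p \<noteq> q" "u \<noteq> 0"
  shows "(harmonic_coord p q has_real_derivative - (1 / u\<^sup>2) / (1 / p - 1 / q)) (at u)"
  unfolding harmonic_coord_def [abs_def]
  using assms by (auto intro!: derivative_eq_intros simp: power2_eq_square)

text \<open>
  With \<open>T = harmonic_coord p q u\<close>, the choice of \<open>q / m\<close> as second point makes the mean in the
  convexity inequality equal to \<open>p q / (T q + (1 - T) p)\<close>, which is \<open>u\<close> by the definition of \<open>T\<close>.
\<close>

lemma harmonically_convex_pointwise_bound: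
  assumes "harmonically_convex \<alpha> m f" "0 < m" "0 < p" "0 < q" "p \<noteq> q" "0 < u"
    and t: "harmonic_coord p q u \<in> {0..1}"
  shows "f u \<le> rpow (harmonic_coord p q u) \<alpha> * f p
           + m * (1 - rpow (harmonic_coord p q u) \<alpha>) * f (q / m)"
proof -
  define t where "t = harmonic_coord p q u"
  have "t * (q - p) * u = p * (q - u)"
    using assms by (simp add: t_def harmonic_coord_def field_simps)
  then have "u * (t * q + (1 - t) * p) = p * q"
    by (simp add: algebra_simps)
  moreover from this have "t * q + (1 - t) * p \<noteq> 0"
    using assms by (metis mult_eq_0_iff less_irrefl)
  ultimately have "p * q / (t * q + (1 - t) * p) = u" by (simp add: field_simps)
  then have "m * p * (q / m) / (m * t * (q / m) + (1 - t) * p) = u"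
    using \<open>0 < m\<close> by simp
  moreover have "f (m * p * (q / m) / (m * t * (q / m) + (1 - t) * p))
      \<le> rpow t \<alpha> * f p + m * (1 - rpow t \<alpha>) * f (q / m)"
    using assms(1)[unfolded harmonically_convex_def, rule_format, of p "q / m" t] assms(2-4) t
    by (simp add: t_def)
  ultimately show ?thesis by (simp add: t_def)
qed

text \<open>
  Since \<open>T = harmonic_coord p q\<close> satisfies \<open>T' u = - 1 / (u\<^sup>2 (1 / p - 1 / q))\<close>, an antiderivative
  of the integrand is a multiple of \<open>T ^ (\<alpha> + 1)\<close>. It is differentiated only inside the interval,
  because the power function need not be differentiable where \<open>T\<close> vanishes.
\<close>

lemma has_integral_rpow_harmonic_coord:
  assumes "0 \<le> \<alpha>" "0 < a" "a < b" and pq: "(p, q) = (a, b) \<or> (p, q) = (b, a)"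
  shows "((\<lambda>u. rpow (harmonic_coord p q u) \<alpha> / u\<^sup>2) has_integral
           (1 / a - 1 / b) / (\<alpha> + 1)) {a..b}"
proof -
  let ?T = "harmonic_coord p q"
  define F where "F = (\<lambda>u. - (1 / p - 1 / q) / (\<alpha> + 1) * ?T u powr (\<alpha> + 1))"
  have pos: "0 < p" "0 < q" "p \<noteq> q" using assms by auto
  then have D: "1 / p - 1 / q \<noteq> 0" by (simp add: field_simps)
  have T_cont: "continuous_on {a..b} ?T"
    using \<open>0 < a\<close> pos
    by (intro DERIV_continuous_on[OF has_field_derivative_at_within[OF harmonic_coord_deriv]]) auto
  have "continuous_on {a..b} F"
    unfolding F_def using harmonic_coord_mem(1)[OF assms(2,3) pq] \<open>0 \<le> \<alpha>\<close>
    by (intro continuous_on_mult continuous_on_const continuous_on_powr' T_cont) auto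
  moreover have "(F has_vector_derivative rpow (?T u) \<alpha> / u\<^sup>2) (at u)" if u: "u \<in> {a<..<b}" for u
  proof -
    have T: "0 < ?T u" using harmonic_coord_mem(2)[OF assms(2,3) pq] u by auto
    then have r: "rpow (?T u) \<alpha> = ?T u powr \<alpha>" by (simp add: rpow_def)
    have "((\<lambda>u. ?T u powr (\<alpha> + 1)) has_real_derivative
        (\<alpha> + 1) * ?T u powr \<alpha> * (- (1 / u\<^sup>2) / (1 / p - 1 / q))) (at u)"
      using DERIV_fun_powr[OF harmonic_coord_deriv[OF pos, of u] T, of "\<alpha> + 1"] u \<open>0 < a\<close> by simp
    from DERIV_cmult[OF this, of "- (1 / p - 1 / q) / (\<alpha> + 1)"]
    have "(F has_real_derivative - (1 / p - 1 / q) / (\<alpha> + 1) *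
        ((\<alpha> + 1) * ?T u powr \<alpha> * (- (1 / u\<^sup>2) / (1 / p - 1 / q)))) (at u)"
      by (simp add: F_def)
    also have "- (1 / p - 1 / q) / (\<alpha> + 1) *
        ((\<alpha> + 1) * ?T u powr \<alpha> * (- (1 / u\<^sup>2) / (1 / p - 1 / q))) = rpow (?T u) \<alpha> / u\<^sup>2"
    proof -
      have cancel: "- d / c * (c * w * (- (1 / v) / d)) = w / v" if "d \<noteq> 0" "c \<noteq> 0" for c d v w :: real
        using that by simp
      show ?thesis unfolding r by (rule cancel[OF D]) (use \<open>0 \<le> \<alpha>\<close> in simp)
    qed
    finally show ?thesis by (simp add: has_real_derivative_iff_has_vector_derivative)
  qed
  ultimately have "((\<lambda>u. rpow (?T u) \<alpha> / u\<^sup>2) has_integral F b - F a) {a..b}"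
    using \<open>a < b\<close> by (intro fundamental_theorem_of_calculus_interior) auto
  moreover have "F b - F a = (1 / a - 1 / b) / (\<alpha> + 1)"
    using pq harmonic_coord_ends[OF pos] \<open>0 \<le> \<alpha>\<close>
    by (auto simp: F_def diff_divide_distrib)
  ultimately show ?thesis by simp
qed

text \<open>The weight is continuous, hence bounded, because the interval stays away from \<open>0\<close>.\<close>

lemma set_integrable_divide_square:
  fixes f :: "real \<Rightarrow> real"
  assumes "0 < a" "set_integrable lebesgue {a..b} f"
  shows "set_integrable lebesgue {a..b} (\<lambda>u. f u / u\<^sup>2)"
proof -
  have c: "continuous_on {a..b} (\<lambda>u. 1 / u\<^sup>2)"
    using \<open>0 < a\<close> by (intro continuous_intros) auto
  have "(\<lambda>u. (1 / u\<^sup>2) * f u) absolutely_integrable_on {a..b}"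
    using assms(2)
    by (intro absolutely_integrable_bounded_measurable_product_real
        continuous_imp_measurable_on_sets_lebesgue c
        compact_imp_bounded compact_continuous_image) auto
  then show ?thesis by simp
qed

lemma harmonic_hermite_hadamard_one_sided:
  fixes f :: "real \<Rightarrow> real"
  assumes "0 \<le> \<alpha>" "0 < m" "harmonically_convex \<alpha> m f" "0 < a" "a < b"
    and "set_integrable lebesgue {a..b} f"
    and pq: "(p, q) = (a, b) \<or> (p, q) = (b, a)"
  shows "a * b / (b - a) * (LINT u:{a..b}|lebesgue. f u / u\<^sup>2)
    \<le> (f p + \<alpha> * m * f (q / m)) / (\<alpha> + 1)"
proof -
  let ?r = "\<lambda>u. rpow (harmonic_coord p q u) \<alpha>"
  define D where "D = 1 / a - 1 / b"
  have D: "0 < D" "a * b / (b - a) = 1 / D"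
    using assms by (auto simp: D_def field_simps)
  have lhs: "((\<lambda>u. f u / u\<^sup>2) has_integral (LINT u:{a..b}|lebesgue. f u / u\<^sup>2)) {a..b}"
    using assms by (intro has_integral_set_lebesgue set_integrable_divide_square)
  have I: "((\<lambda>u. ?r u / u\<^sup>2) has_integral D / (\<alpha> + 1)) {a..b}"
    unfolding D_def using assms by (intro has_integral_rpow_harmonic_coord)
  \<comment> \<open>The exponent \<open>0\<close> gives the total mass of the weight \<open>1 / u\<^sup>2\<close>.\<close>
  have J: "((\<lambda>u. 1 / u\<^sup>2) has_integral D) {a..b}"
    using has_integral_rpow_harmonic_coord[of 0 a b p q] assms by (simp add: rpow_def D_def)
  have "((\<lambda>u. f p * (?r u / u\<^sup>2) + m * f (q / m) * (1 / u\<^sup>2 - ?r u / u\<^sup>2)) has_integral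
      f p * (D / (\<alpha> + 1)) + m * f (q / m) * (D - D / (\<alpha> + 1))) {a..b}"
    by (intro has_integral_add has_integral_diff has_integral_mult_right I J)
  then have "(LINT u:{a..b}|lebesgue. f u / u\<^sup>2)
      \<le> f p * (D / (\<alpha> + 1)) + m * f (q / m) * (D - D / (\<alpha> + 1))"
  proof (rule has_integral_le[OF lhs])
    fix u assume u: "u \<in> {a..b}"
    have "f u \<le> ?r u * f p + m * (1 - ?r u) * f (q / m)"
      using assms u harmonic_coord_mem(1)[OF assms(4,5) pq u]
      by (intro harmonically_convex_pointwise_bound) auto
    then have "f u / u\<^sup>2 \<le> (?r u * f p + m * (1 - ?r u) * f (q / m)) / u\<^sup>2"
      by (rule divide_right_mono) simp
    then show "f u / u\<^sup>2 \<le> f p * (?r u / u\<^sup>2) + m * f (q / m) * (1 / u\<^sup>2 - ?r u / u\<^sup>2)"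
      by (simp add: add_divide_distrib diff_divide_distrib algebra_simps)
  qed
  also have "\<dots> = D * ((f p + \<alpha> * m * f (q / m)) / (\<alpha> + 1))"
  proof -
    have "x * (D / c) + y * (D - D / c) = D * ((x + (c - 1) * y) / c)" if "c \<noteq> 0" for x y c :: real
      using that by (simp add: field_simps)
    from this[of "\<alpha> + 1" "f p" "m * f (q / m)"] show ?thesis
      using \<open>0 \<le> \<alpha>\<close> by (simp add: mult.assoc)
  qed
  finally show ?thesis
    unfolding D(2) using D(1) by (simp add: pos_divide_le_eq mult.commute)
qed

theorem theorem4:
  fixes f :: "real \<Rightarrow> real" and \<alpha> m a b :: real
  assumes "\<alpha> \<in> {0..1}"
    and "m \<in> {0<..1}"
    and "harmonically_convex \<alpha> m f"
    and "0 < a" and "a < b"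
    and "set_integrable lebesgue {a..b} f"
  shows "a * b / (b - a) * (LINT x:{a..b}|lebesgue. f x / x\<^sup>2)
    \<le> min ((f a + \<alpha> * m * f (b / m)) / (\<alpha> + 1))
          ((f b + \<alpha> * m * f (a / m)) / (\<alpha> + 1))"
  using harmonic_hermite_hadamard_one_sided[of \<alpha> m f a b a b]
    harmonic_hermite_hadamard_one_sided[of \<alpha> m f a b b a] assms
  by simp

end
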